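(* Let $(i,j)$ be real numbers with $0<i,j<1$ and $i+j=1$, and let $\mathcal{D}=(d_k)_{k\ge1}$ be a bounded sequence of integers with $d_k\ge 2$ for all $k$. Then the set \[ \mathrm{Bad}_{\mathcal{D}}(i,j)=\Big\{x\in\mathbb{R} : \exists\, c(x)>0 \text{ such that } \max\big\{|q|_{\mathcal{D}}^{1/i},\ \|qx\|^{1/j}\big\}>\tfrac{c(x)}{q}\ \ \forall q\in\mathbb{N}\Big\} \] is $(\alpha,\beta)$-winning for every admissible pair $(\alpha,\beta)$. In particular, $\mathrm{Bad}_{\mathcal{D}}(i,j)$ is $1/2$-winning.
   Context: $\|y\|$ denotes the distance from a real number $y$ to the nearest integer. For $\mathcal{D}=(d_k)$ set $D_0=1$, $D_n=\prod_{k=1}^n d_k$, and for $q\in\mathbb{N}$ define the $\mathcal{D}$-adic pseudo absolute value $|q|_{\mathcal{D}}=\inf\{1/D_n : q\in D_n\mathbb{Z}\}$. Schmidt's game on $\mathbb{R}$ with parameters $0<\alpha,\beta<1$ and target set $S\subset\mathbb{R}$: Bob chooses a closed interval $B_1$; then alternately Alice chooses a closed interval $A_k\subset B_k$ with $\rho(A_k)=\alpha\rho(B_k)$ and Bob chooses a closed interval $B_{k+1}\subset A_k$ with $\rho(B_{k+1})=\beta\rho(A_k)$, where $\rho(I)$ is half the length of $I$. Alice wins if the unique point of $\bigcap_k A_k$ lies in $S$. $S$ is $(\alpha,\beta)$-winning if Alice has a strategy winning against every play of Bob, and $\alpha$-winning if it is $(\alpha,\beta)$-winning for every $0<\beta<1$.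 A pair $(\alpha,\beta)$ with $0<\alpha,\beta<1$ is admissible if $\gamma:=1-2\alpha+\alpha\beta>0$. *)

theory Defs
  imports "HOL-Analysis.Analysis"
begin

definition dist_nearest_int :: "real \<Rightarrow> real" where
  "dist_nearest_int y = \<bar>y - of_int (round y)\<bar>"

text \<open>Sequences \<open>d\<close> are indexed from 1; the value \<open>d 0\<close> is never used.\<close>

definition partial_product :: "(nat \<Rightarrow> int) \<Rightarrow> nat \<Rightarrow> int" where
  "partial_product d n = (\<Prod>k=1..n. d k)"

definition dadic_abs :: "(nat \<Rightarrow> int) \<Rightarrow> nat \<Rightarrow> real" where
  "dadic_abs d q = Inf {1 / real_of_int (partial_product d n) | n. partial_product d n dvd int q}"

definition Bad :: "(nat \<Rightarrow> int) \<Rightarrow> real \<Rightarrow> real \<Rightarrow> real set" where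
  "Bad d i j = {x. \<exists>c>0. \<forall>q::nat. q \<ge> 1 \<longrightarrow>
     max (dadic_abs d q powr (1 / i)) (dist_nearest_int (real q * x) powr (1 / j)) > c / real q}"

text \<open>In Schmidt's game all intervals are nondegenerate: if Bob could open with a single point,
  only the whole line would be winning.\<close>

definition closed_interval :: "real set \<Rightarrow> bool" where
  "closed_interval I \<longleftrightarrow> (\<exists>a b. a < b \<and> I = {a..b})"

definition radius :: "real set \<Rightarrow> real" where
  "radius I = (Sup I - Inf I) / 2"

definition legal_move :: "real \<Rightarrow> real set \<Rightarrow> real set \<Rightarrow> bool" where
  "legal_move r I J \<longleftrightarrow> closed_interval J \<and> J \<subseteq> I \<and> radius J = r * radius I"

text \<open>A strategy for Alice maps the list of Bob's moves so far to her next move (her own earlier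
  moves are determined by these). Rounds are counted from 0: \<open>B k\<close> is Bob's move in round \<open>k\<close>
  and \<open>reply \<sigma> B k\<close> is Alice's answer to it.\<close>

definition reply :: "(real set list \<Rightarrow> real set) \<Rightarrow> (nat \<Rightarrow> real set) \<Rightarrow> nat \<Rightarrow> real set" where
  "reply \<sigma> B k = \<sigma> (map B [0..<Suc k])"

definition bob_legal_upto ::
  "real \<Rightarrow> (real set list \<Rightarrow> real set) \<Rightarrow> (nat \<Rightarrow> real set) \<Rightarrow> nat \<Rightarrow> bool" where
  "bob_legal_upto \<beta> \<sigma> B n \<longleftrightarrow>
     closed_interval (B 0) \<and> (\<forall>k<n. legal_move \<beta> (reply \<sigma> B k) (B (Suc k)))"

text \<open>The strategy must answer every finite legal history by a legal move. Restricting attention to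
  infinite plays would not suffice: Alice could then win vacuously by an illegal move (such as
  the empty set) that leaves Bob without a continuation.\<close>

definition legal_strategy :: "real \<Rightarrow> real \<Rightarrow> (real set list \<Rightarrow> real set) \<Rightarrow> bool" where
  "legal_strategy \<alpha> \<beta> \<sigma> \<longleftrightarrow>
     (\<forall>B n. bob_legal_upto \<beta> \<sigma> B n \<longrightarrow> legal_move \<alpha> (B n) (reply \<sigma> B n))"

definition pair_winning :: "real \<Rightarrow> real \<Rightarrow> real set \<Rightarrow> bool" where
  "pair_winning \<alpha> \<beta> S \<longleftrightarrow>
     (\<exists>\<sigma>. legal_strategy \<alpha> \<beta> \<sigma> \<and>
        (\<forall>B. (\<forall>n. bob_legal_upto \<beta> \<sigma> B n) \<longrightarrow> (\<exists>x\<in>S. (\<Inter>k. reply \<sigma> B k) = {x})))"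

definition winning :: "real \<Rightarrow> real set \<Rightarrow> bool" where
  "winning \<alpha> S \<longleftrightarrow> (\<forall>\<beta>. 0 < \<beta> \<and> \<beta> < 1 \<longrightarrow> pair_winning \<alpha> \<beta> S)"

definition admissible_pair :: "real \<Rightarrow> real \<Rightarrow> bool" where
  "admissible_pair \<alpha> \<beta> \<longleftrightarrow>
     0 < \<alpha> \<and> \<alpha> < 1 \<and> 0 < \<beta> \<and> \<beta> < 1 \<and> 1 - 2 * \<alpha> + \<alpha> * \<beta> > 0"

end

theory Submission
  imports Defs
begin

text \<open>If \<open>q\<close> violates the condition defining \<open>Bad\<close> with a constant \<open>c\<close>, then \<open>x\<close> lies within
  \<open>c\<^sup>j q\<^sup>-\<^sup>1\<^sup>-\<^sup>j\<close> of some \<open>p / q\<close>, where a partial product \<open>D \<ge> (q / c)\<^sup>i\<close> divides \<open>q\<close>. Two such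
  fractions with comparable denominators share the smaller of the two partial products as a common
  factor of their denominators, so they are at distance at least \<open>c\<^sup>-\<^sup>i q\<^sup>-\<^sup>1\<^sup>-\<^sup>j\<close>, up to a constant. Hence,
  for \<open>c\<close> small in terms of Bob's first interval, an interval of radius about \<open>q\<^sup>-\<^sup>1\<^sup>-\<^sup>j\<close> meets at most
  one of them, and Alice evades it by always moving away from it: each round moves the midpoint of
  Bob's interval by at least \<open>1 - 2\<alpha> + \<alpha>\<beta>\<close> times its radius.\<close>

section \<open>Evading isolated points in Schmidt's game\<close>

definition midpoint_of :: "real set \<Rightarrow> real" where
  "midpoint_of I = (Inf I + Sup I) / 2"

text \<open>Alice only ever plays flush with one end of Bob's interval, so her strategy reduces to a
  choice of direction in each round.\<close>

definition end_move :: "real \<Rightarrow> bool \<Rightarrow> real set \<Rightarrow> real set" where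
  "end_move \<alpha> right I =
     (if right then {Sup I - 2 * \<alpha> * radius I..Sup I} else {Inf I..Inf I + 2 * \<alpha> * radius I})"

lemma radius_pos:
  assumes "closed_interval I"
  shows "radius I > 0"
  using assms by (auto simp: closed_interval_def radius_def)

lemma dist_midpoint_le:
  assumes "closed_interval I" "x \<in> I"
  shows "\<bar>x - midpoint_of I\<bar> \<le> radius I"
  using assms by (auto simp: closed_interval_def midpoint_of_def radius_def abs_le_iff field_simps)

lemma legal_end_move:
  assumes "closed_interval I" "0 < \<alpha>" "\<alpha> < 1"
  shows "legal_move \<alpha> I (end_move \<alpha> right I)"
proof -
  obtain l u where I: "I = {l..u}" "l < u"
    using assms(1) by (auto simp: closed_interval_def)
  have 1: "0 < \<alpha> * (u - l)" "\<alpha> * (u - l) < u - l"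
    using I assms by auto
  show ?thesis
    using I 1 by (auto simp: legal_move_def end_move_def radius_def closed_interval_def)
qed

text \<open>Alice shifts the midpoint by (1 - \<alpha>) times the radius of \<open>I\<close>, and
  Bob can take back at most \<alpha> (1 - \<beta>) times that radius. The difference of the two
  factors is 1 - 2 \<alpha> + \<alpha> \<beta>.\<close>

lemma midpoint_end_move:
  assumes "closed_interval I" "0 < \<alpha>" and J: "legal_move \<beta> (end_move \<alpha> right I) J"
  shows "right \<Longrightarrow> midpoint_of J \<ge> midpoint_of I + (1 - 2 * \<alpha> + \<alpha> * \<beta>) * radius I"
    and "\<not> right \<Longrightarrow> midpoint_of J \<le> midpoint_of I - (1 - 2 * \<alpha> + \<alpha> * \<beta>) * radius I"
proof -
  obtain l u where I: "I = {l..u}" "l < u"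
    using assms(1) by (auto simp: closed_interval_def)
  obtain a b where ab: "J = {a..b}" "a < b"
    using J by (auto simp: legal_move_def closed_interval_def)
  have pos: "0 < \<alpha> * (u - l)"
    using I assms by auto
  have sub: "J \<subseteq> end_move \<alpha> right I" and rad: "radius J = \<beta> * radius (end_move \<alpha> right I)"
    using J by (auto simp: legal_move_def)
  show "midpoint_of J \<ge> midpoint_of I + (1 - 2 * \<alpha> + \<alpha> * \<beta>) * radius I" if right
  proof -
    have "a \<ge> u - \<alpha> * (u - l)" "b - a = \<beta> * (\<alpha> * (u - l))"
      using sub rad pos that I ab by (auto simp: end_move_def radius_def)
    then show ?thesis
      using I ab by (simp add: midpoint_of_def radius_def field_simps)
  qed
  show "midpoint_of J \<le> midpoint_of I - (1 - 2 * \<alpha> + \<alpha> * \<beta>) * radius I" if "\<not> right"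
  proof -
    have "b \<le> l + \<alpha> * (u - l)" "b - a = \<beta> * (\<alpha> * (u - l))"
      using sub rad pos that I ab by (auto simp: end_move_def radius_def)
    then show ?thesis
      using I ab by (simp add: midpoint_of_def radius_def field_simps)
  qed
qed

lemma radius_end_move:
  assumes "closed_interval I" "0 < \<alpha>" "\<alpha> < 1"
  shows "radius (end_move \<alpha> right I) = \<alpha> * radius I" "closed_interval (end_move \<alpha> right I)"
    "end_move \<alpha> right I \<subseteq> I"
  using legal_end_move[OF assms] by (auto simp: legal_move_def)

text \<open>Compactness gives a common point, and two common points are at most twice each radius
  apart.\<close>

lemma Inter_nested_closed_intervals:
  assumes ci: "\<And>n. closed_interval (A n)" and nest: "\<And>n. A (Suc n) \<subseteq> A n"
    and rad: "(\<lambda>n. radius (A n)) \<longlonglongrightarrow> 0"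
  obtains x where "(\<Inter>n. A n) = {x}"
proof -
  have decr: "A n \<subseteq> A m" if "m \<le> n" for m n
    using lift_Suc_antimono_le[of A, OF nest that] .
  have "compact (A n)" "A n \<noteq> {}" for n
    using ci[of n] by (auto simp: closed_interval_def)
  then have "(\<Inter>n. A n) \<noteq> {}"
    by (rule compact_nest) (use decr in auto)
  then obtain x where x: "\<And>n. x \<in> A n"
    by blast
  have "y = x" if y: "\<And>n. y \<in> A n" for y
  proof -
    have "\<bar>y - x\<bar> \<le> 2 * radius (A n)" for n
    proof -
      obtain a b where "a < b" "A n = {a..b}"
        using ci[of n] by (auto simp: closed_interval_def)
      then have "x \<in> {a..b}" "y \<in> {a..b}" "2 * radius (A n) = b - a"
        using x[of n] y[of n] by (simp_all add: radius_def)
      then show ?thesis by auto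
    qed
    moreover have "(\<lambda>n. 2 * radius (A n)) \<longlonglongrightarrow> 0"
      using tendsto_mult_right_zero[OF rad] .
    ultimately have "\<bar>y - x\<bar> \<le> 0"
      using LIMSEQ_le_const[of "\<lambda>n. 2 * radius (A n)" 0] by meson
    then show ?thesis by simp
  qed
  then have "(\<Inter>n. A n) = {x}"
    using x by auto
  then show ?thesis by (rule that)
qed

text \<open>The play is cut into blocks of \<open>t\<close> rounds; block \<open>k\<close> starts
  with an interval of radius \<rho> r^k, where r = (\<alpha>\<beta>)^t. By the separation at most
  one point of \<open>Z k\<close> is near its midpoint, and Alice spends the whole block moving away
  from it. The midpoint gains at least \<gamma> \<rho> r^k, while the radius at the end of the block
  is at most half of that, so the other half remains as distance. The family \<open>Z\<close> is
  chosen after \<rho>, the radius of Bob's first interval, whereas \<open>t\<close> is fixed in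
  advance.\<close>

lemma pair_winning_if_separated:
  assumes adm: "admissible_pair \<alpha> \<beta>"
    and t: "0 < t" "(\<alpha> * \<beta>) ^ t \<le> (1 - 2 * \<alpha> + \<alpha> * \<beta>) / 2"
    and Z: "\<And>\<rho>. \<rho> > 0 \<Longrightarrow> \<exists>Z :: nat \<Rightarrow> real set.
      (\<forall>k. \<forall>u\<in>Z k. \<forall>v\<in>Z k. \<bar>u - v\<bar> \<le> 4 * \<rho> * ((\<alpha> * \<beta>) ^ t) ^ k \<longrightarrow> u = v) \<and>
      (\<forall>x. (\<forall>k. \<forall>z\<in>Z k. \<bar>x - z\<bar> \<ge> (1 - 2 * \<alpha> + \<alpha> * \<beta>) / 2 * (\<rho> * ((\<alpha> * \<beta>) ^ t) ^ k)) \<longrightarrow> x \<in> S)"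
  shows "pair_winning \<alpha> \<beta> S"
proof -
  define \<gamma> where "\<gamma> = 1 - 2 * \<alpha> + \<alpha> * \<beta>"
  define r where "r = (\<alpha> * \<beta>) ^ t"
  have ab: "0 < \<alpha>" "\<alpha> < 1" "0 < \<beta>" "\<beta> < 1" and \<gamma>: "\<gamma> > 0"
    using adm by (auto simp: admissible_pair_def \<gamma>_def)
  have \<gamma>1: "\<gamma> < 1"
    using mult_strict_left_mono[OF \<open>\<beta> < 1\<close> \<open>0 < \<alpha>\<close>] ab by (simp add: \<gamma>_def)
  have prod: "0 < \<alpha> * \<beta>" "\<alpha> * \<beta> < 1"
    using ab mult_strict_mono[of \<alpha> 1 \<beta> 1] by auto
  have r: "0 < r" "r \<le> \<gamma> / 2"
    using prod t by (auto simp: r_def \<gamma>_def)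
  define good where "good \<rho> Z \<longleftrightarrow>
      (\<forall>k. \<forall>u\<in>Z k. \<forall>v\<in>Z k. \<bar>u - v\<bar> \<le> 4 * \<rho> * r ^ k \<longrightarrow> u = v) \<and>
      (\<forall>x. (\<forall>k. \<forall>z\<in>Z k. \<bar>x - z\<bar> \<ge> \<gamma> / 2 * (\<rho> * r ^ k)) \<longrightarrow> x \<in> S)" for \<rho> and Z :: "nat \<Rightarrow> real set"
  \<comment> \<open>Alice learns \<rho> only from Bob's opening move, so one strategy must hold a
    family for every \<rho>.\<close>
  define Z where "Z \<rho> = (SOME Z. good \<rho> Z)" for \<rho>
  have good: "good \<rho> (Z \<rho>)" if "\<rho> > 0" for \<rho>
    unfolding Z_def using Z[OF that] unfolding good_def r_def \<gamma>_def by (rule someI_ex)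
  have sep: "u = v" if "\<rho> > 0" "u \<in> Z \<rho> k" "v \<in> Z \<rho> k" "\<bar>u - v\<bar> \<le> 4 * \<rho> * r ^ k" for \<rho> k u v
    using good[OF that(1)] that(2-) unfolding good_def by blast
  have inS: "x \<in> S" if "\<rho> > 0" "\<And>k z. z \<in> Z \<rho> k \<Longrightarrow> \<bar>x - z\<bar> \<ge> \<gamma> / 2 * (\<rho> * r ^ k)" for \<rho> x
    using good[OF that(1)] that(2) unfolding good_def by blast
  \<comment> \<open>True means that Alice goes right because a nearby point of \<open>Z\<close> lies
    at or to the left of the midpoint \<open>m\<close>. If no point is near, she goes left, which is
    then harmless.\<close>
  define dir where "dir \<rho> k m \<longleftrightarrow> (\<exists>z \<in> Z \<rho> k. z \<le> m \<and> \<bar>z - m\<bar> \<le> 2 * \<rho> * r ^ k)" for \<rho> k m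
  \<comment> \<open>The current round is \<open>n\<close>, its block is \<open>n div t\<close>, and
    that block began in round \<open>n div t * t\<close>. Reading the direction off the first
    interval of the block keeps it constant throughout the block.\<close>
  define \<sigma> where "\<sigma> h = (let n = length h - 1 in
     end_move \<alpha> (dir (radius (h ! 0)) (n div t) (midpoint_of (h ! (n div t * t)))) (h ! n))" for h
  have reply: "reply \<sigma> B n =
      end_move \<alpha> (dir (radius (B 0)) (n div t) (midpoint_of (B (n div t * t)))) (B n)" for B n
  proof -
    have "n div t * t \<le> n" by simp
    then have "map B [0..<Suc n] ! (n div t * t) = B (n div t * t)" "map B [0..<Suc n] ! 0 = B 0"
      "map B [0..<Suc n] ! n = B n"
      by (simp_all only: nth_map_upt) (simp_all add: nth_append)
    then show ?thesis
      unfolding reply_def \<sigma>_def Let_def by simp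
  qed
  have "legal_strategy \<alpha> \<beta> \<sigma>"
    unfolding legal_strategy_def
  proof (intro allI impI)
    fix B n assume "bob_legal_upto \<beta> \<sigma> B n"
    then have "closed_interval (B n)"
      by (cases n) (auto simp: bob_legal_upto_def legal_move_def)
    then show "legal_move \<alpha> (B n) (reply \<sigma> B n)"
      unfolding reply using ab by (intro legal_end_move)
  qed
  moreover have "\<exists>x\<in>S. (\<Inter>k. reply \<sigma> B k) = {x}" if legal: "\<forall>n. bob_legal_upto \<beta> \<sigma> B n" for B
  proof -
    define \<rho> where "\<rho> = radius (B 0)"
    have step: "legal_move \<beta> (reply \<sigma> B n) (B (Suc n))" for n
      using legal by (auto simp: bob_legal_upto_def)
    have ci: "closed_interval (B n)" for n
      using legal step by (cases n) (auto simp: bob_legal_upto_def legal_move_def)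
    have rA: "radius (reply \<sigma> B n) = \<alpha> * radius (B n)" "closed_interval (reply \<sigma> B n)"
      "reply \<sigma> B n \<subseteq> B n" for n
      unfolding reply by (intro radius_end_move ci ab)+
    have rB: "radius (B n) = \<rho> * (\<alpha> * \<beta>) ^ n" for n
    proof (induction n)
      case (Suc n)
      then show ?case
        using step[of n] rA(1)[of n] by (simp add: legal_move_def)
    qed (simp add: \<rho>_def)
    have rpos: "radius (B n) > 0" for n
      using radius_pos[OF ci] .
    then have \<rho>: "\<rho> > 0"
      by (simp add: \<rho>_def)
    have "(\<lambda>n. \<alpha> * (\<rho> * (\<alpha> * \<beta>) ^ n)) \<longlonglongrightarrow> \<alpha> * (\<rho> * 0)"
      using prod by (intro tendsto_mult tendsto_const LIMSEQ_power_zero) auto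
    then have "(\<lambda>n. radius (reply \<sigma> B n)) \<longlonglongrightarrow> 0"
      by (simp add: rA(1) rB)
    moreover have "reply \<sigma> B (Suc n) \<subseteq> reply \<sigma> B n" for n
      using rA(3)[of "Suc n"] step[of n] by (auto simp: legal_move_def)
    ultimately obtain x where x: "(\<Inter>k. reply \<sigma> B k) = {x}"
      using Inter_nested_closed_intervals[of "reply \<sigma> B"] rA(2) by blast
    then have xB: "x \<in> B n" for n
      using rA(3)[of n] by blast
    have xdist: "\<bar>x - midpoint_of (B n)\<bar> \<le> radius (B n)" for n
      using dist_midpoint_le[OF ci xB] .
    have "x \<in> S"
    proof (rule inS[OF \<rho>])
      fix k z assume z: "z \<in> Z \<rho> k"
      define m where "m = midpoint_of (B (k * t))"
      define \<rho>k where "\<rho>k = \<rho> * r ^ k"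
      have \<rho>k: "radius (B (k * t)) = \<rho>k"
        by (simp add: rB \<rho>k_def r_def power_mult[symmetric] mult.commute)
      have \<rho>kpos: "\<rho>k > 0"
        using \<rho>k rpos by metis
      have rend: "radius (B (k * t + t)) = r * \<rho>k"
        using \<rho>k by (simp add: rB power_add r_def)
      have rep: "reply \<sigma> B (k * t + s) = end_move \<alpha> (dir \<rho> k m) (B (k * t + s))" if "s < t" for s
        using that by (simp add: reply \<rho>_def m_def)
      have rend_le: "r * \<rho>k \<le> \<gamma> / 2 * \<rho>k"
        using r(2) \<rho>kpos by (intro mult_right_mono) auto
      \<comment> \<open>The first round of the block yields the whole displacement; the later ones
        push in the same direction and cannot undo it.\<close>
      have mono_right: "midpoint_of (B (k * t + Suc s)) \<ge> m + \<gamma> * \<rho>k" if "dir \<rho> k m" "s < t" for s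
        using that(2)
      proof (induction s)
        case 0
        show ?case
          using midpoint_end_move(1)[OF ci ab(1), of \<beta> "dir \<rho> k m" "k * t + 0"] step[of "k * t + 0"] 0
            rep[of 0] that \<rho>k
          by (simp add: \<gamma>_def m_def)
      next
        case (Suc s)
        have "midpoint_of (B (k * t + Suc s)) + \<gamma> * radius (B (k * t + Suc s))
            \<le> midpoint_of (B (k * t + Suc (Suc s)))"
          using midpoint_end_move(1)[OF ci ab(1), of \<beta> "dir \<rho> k m" "k * t + Suc s"]
            step[of "k * t + Suc s"] rep[OF Suc.prems] that
          by (simp add: \<gamma>_def)
        moreover have "\<gamma> * radius (B (k * t + Suc s)) > 0"
          using \<gamma> rpos by simp
        ultimately show ?case
          using Suc by simp
      qed
      have mono_left: "midpoint_of (B (k * t + Suc s)) \<le> m - \<gamma> * \<rho>k" if "\<not> dir \<rho> k m" "s < t" for s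
        using that(2)
      proof (induction s)
        case 0
        show ?case
          using midpoint_end_move(2)[OF ci ab(1), of \<beta> "dir \<rho> k m" "k * t + 0"] step[of "k * t + 0"] 0
            rep[of 0] that \<rho>k
          by (simp add: \<gamma>_def m_def)
      next
        case (Suc s)
        have "midpoint_of (B (k * t + Suc s)) - \<gamma> * radius (B (k * t + Suc s))
            \<ge> midpoint_of (B (k * t + Suc (Suc s)))"
          using midpoint_end_move(2)[OF ci ab(1), of \<beta> "dir \<rho> k m" "k * t + Suc s"]
            step[of "k * t + Suc s"] rep[OF Suc.prems] that
          by (simp add: \<gamma>_def)
        moreover have "\<gamma> * radius (B (k * t + Suc s)) > 0"
          using \<gamma> rpos by simp
        ultimately show ?case
          using Suc by simp
      qed
      have "\<bar>x - z\<bar> \<ge> \<gamma> / 2 * \<rho>k"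
      proof (cases "\<bar>z - m\<bar> \<le> 2 * \<rho>k")
        \<comment> \<open>The outcome \<open>x\<close> lies within \<open>\<rho>k\<close> of
          \<open>m\<close>, so a point more than 2 \<open>\<rho>k\<close> away from \<open>m\<close>
          needs no evasion.\<close>
        case False
        have "\<gamma> / 2 * \<rho>k \<le> 1 * \<rho>k"
          using \<gamma>1 \<rho>kpos by (intro mult_right_mono) auto
        moreover have "\<bar>x - m\<bar> \<le> \<rho>k"
          using xdist[of "k * t"] \<rho>k by (simp add: m_def)
        ultimately show ?thesis
          using False by linarith
      next
        case near: True
        have xend: "\<bar>x - midpoint_of (B (k * t + t))\<bar> \<le> \<gamma> / 2 * \<rho>k"
          using xdist[of "k * t + t"] rend rend_le by linarith
        have Suc: "Suc (t - 1) = t" "t - 1 < t"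
          using t(1) by auto
        show ?thesis
        proof (cases "dir \<rho> k m")
          case True
          then obtain z' where z': "z' \<in> Z \<rho> k" "z' \<le> m" "\<bar>z' - m\<bar> \<le> 2 * \<rho>k"
            by (auto simp: dir_def \<rho>k_def mult.assoc)
          \<comment> \<open>Both points lie within 2 \<open>\<rho>k\<close> of \<open>m\<close>,
            hence within the separation bound 4 \<open>\<rho>k\<close> of each other.\<close>
          have "z = z'"
            using z' near by (intro sep[OF \<rho> z z'(1)]) (simp add: \<rho>k_def)
          with z' have "z \<le> m" by simp
          then show ?thesis
            using mono_right[OF True Suc(2), unfolded Suc(1)] xend by linarith
        next
          case False
          \<comment> \<open>Otherwise \<open>z\<close> itself would have sent Alice to the
            right.\<close>
          then have "z > m"
            using z near by (auto simp: dir_def \<rho>k_def mult.assoc not_le)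
          then show ?thesis
            using mono_left[OF False Suc(2), unfolded Suc(1)] xend by linarith
        qed
      qed
      then show "\<bar>x - z\<bar> \<ge> \<gamma> / 2 * (\<rho> * r ^ k)"
        by (simp add: \<rho>k_def)
    qed
    with x show ?thesis by blast
  qed
  ultimately show ?thesis
    unfolding pair_winning_def by blast
qed

section \<open>Separation of the dangerous fractions\<close>

lemma partial_product_dvd:
  assumes "m \<le> n"
  shows "partial_product d m dvd partial_product d n"
  unfolding partial_product_def using assms by (intro prod_dvd_prod_subset) auto

lemma partial_product_ge_power:
  assumes "\<forall>k\<ge>1. d k \<ge> 2"
  shows "partial_product d n \<ge> 2 ^ n"
proof -
  have "(\<Prod>k=1..n. 2) \<le> (\<Prod>k=1..n. d k)"
    using assms by (intro prod_mono) auto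
  then show ?thesis
    by (simp add: partial_product_def)
qed

text \<open>The infimum is a minimum over a finite set: 2^n \<le> D_n \<le> q whenever D_n divides
  the positive integer \<open>q\<close>, so only \<open>n\<close> below \<open>q\<close> occur, and
  n = 0 always does.\<close>

lemma dadic_abs_attained:
  assumes d: "\<forall>k\<ge>1. d k \<ge> 2" and q: "q \<ge> 1"
  obtains n where "partial_product d n dvd int q"
    "dadic_abs d q = 1 / real_of_int (partial_product d n)"
proof -
  let ?N = "{n. partial_product d n dvd int q}"
  let ?V = "{1 / real_of_int (partial_product d n) | n. partial_product d n dvd int q}"
  have "n < q" if "n \<in> ?N" for n
  proof -
    have "partial_product d n \<le> int q"
      using that q by (intro zdvd_imp_le) auto
    then have "2 ^ n \<le> int q"
      using partial_product_ge_power[OF d, of n] by linarith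
    then have "2 ^ n \<le> q"
      by (metis of_nat_le_iff of_nat_numeral of_nat_power)
    then show ?thesis
      using less_exp[of n] by linarith
  qed
  then have "finite ?N"
    by (meson finite_nat_set_iff_bounded)
  moreover have "?V = (\<lambda>n. 1 / real_of_int (partial_product d n)) ` ?N"
    by auto
  ultimately have "finite ?V" by simp
  moreover have "0 \<in> ?N"
    by (simp add: partial_product_def)
  then have "?V \<noteq> {}" by blast
  ultimately have "Inf ?V \<in> ?V"
    using cInf_eq_Min[of ?V] Min_in[of ?V] by simp
  then have "dadic_abs d q \<in> ?V"
    by (simp only: dadic_abs_def)
  with that show ?thesis by blast
qed

text \<open>The numerator p q' - p' q of the difference is a nonzero multiple of \<open>D\<close>,
  which improves the usual gap 1 / (q q') by the factor \<open>D\<close>.\<close>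

lemma fraction_gap:
  fixes p p' D :: int and q q' :: nat
  assumes "D dvd int q" "D dvd int q'" "q > 0" "q' > 0" "real_of_int p / q \<noteq> real_of_int p' / q'"
  shows "\<bar>real_of_int p / q - real_of_int p' / q'\<bar> \<ge> real_of_int D / (real q * real q')"
proof -
  let ?N = "p * int q' - p' * int q"
  have eq: "real_of_int p / q - real_of_int p' / q' = real_of_int ?N / (real q * real q')"
    using assms(3,4) by (simp add: field_simps)
  have "?N \<noteq> 0"
  proof
    assume "?N = 0"
    then have "real_of_int p / q - real_of_int p' / q' = 0"
      unfolding eq by (simp only: of_int_0 div_0)
    with assms(5) show False by simp
  qed
  moreover have "D dvd ?N"
    using assms(1,2) by simp
  ultimately have "D \<le> \<bar>?N\<bar>"
    using zdvd_imp_le[of D "\<bar>?N\<bar>"] by simp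
  then have "real_of_int D \<le> \<bar>real_of_int ?N\<bar>"
    by linarith
  then show ?thesis
    unfolding eq abs_divide by (simp add: divide_right_mono)
qed

text \<open>These are the fractions whose denominator satisfies |q|_D^(1/i) \<le> c / q, sorted by
  scale: \<open>2 - i\<close> is 1 + j when i + j = 1, so scale \<open>k\<close> collects those with
  q^(-1-j) between r^(k+1) and r^k. Fractions need not be reduced, as separation concerns only
  distinct values.\<close>

definition dangerous :: "(nat \<Rightarrow> int) \<Rightarrow> real \<Rightarrow> real \<Rightarrow> real \<Rightarrow> nat \<Rightarrow> real set" where
  "dangerous d i c r k = {real_of_int p / real q | p q n. q \<ge> 1 \<and> partial_product d n dvd int q \<and>
     real q \<le> c * real_of_int (partial_product d n) powr (1 / i) \<and>
     r ^ Suc k < 1 / real q powr (2 - i) \<and> 1 / real q powr (2 - i) \<le> r ^ k}"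

text \<open>The smaller of the two partial products, \<open>D\<close>, divides both denominators,
  and D \<ge> (q / c)^i for the denominator \<open>q\<close> it belongs to. The gap D / (q q') is
  therefore at least c^(-i) / (q^(1-i) q'), and both denominators are controlled by the
  scale.\<close>

lemma dangerous_separated:
  assumes i: "0 < i" "i < 1" and d: "\<forall>k\<ge>1. d k \<ge> 2" and c: "c > 0" and r: "r > 0"
    and u: "u \<in> dangerous d i c r k" and v: "v \<in> dangerous d i c r k" and "u \<noteq> v"
  shows "\<bar>u - v\<bar> \<ge> r ^ Suc k / c powr i"
proof -
  have main: "\<bar>real_of_int p / real q - real_of_int p' / real q'\<bar> \<ge> r ^ Suc k / c powr i"
    if "q \<ge> 1" "q' \<ge> 1" "partial_product d n dvd int q" "partial_product d n' dvd int q'"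
      and q: "real q \<le> c * real_of_int (partial_product d n) powr (1 / i)"
      and rq: "r ^ Suc k < 1 / real q powr (2 - i)" "r ^ Suc k < 1 / real q' powr (2 - i)"
      and "n \<le> n'" and neq: "real_of_int p / real q \<noteq> real_of_int p' / real q'"
    for p p' q q' n n'
  proof -
    define D where "D = partial_product d n"
    have Dq: "D dvd int q" "D dvd int q'"
      using that partial_product_dvd[OF \<open>n \<le> n'\<close>, of d] dvd_trans unfolding D_def by blast+
    have "(2::int) ^ n > 0" by simp
    then have D: "D > 0"
      using partial_product_ge_power[OF d, of n] unfolding D_def by linarith
    have "real q powr i \<le> (c * real_of_int D powr (1 / i)) powr i"
      using q i by (intro powr_mono2) (auto simp: D_def)
    also have "\<dots> = c powr i * real_of_int D"
      using c D i by (simp add: powr_mult powr_powr)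
    finally have qi: "real q powr i / c powr i \<le> real_of_int D"
      using c by (simp add: field_simps)
    \<comment> \<open>The order of \<open>n\<close> and \<open>n'\<close> does not decide which
      denominator is larger; bounding both by the maximum avoids that case distinction.\<close>
    define M where "M = max (real q) (real q')"
    have M: "M \<ge> 1" "r ^ Suc k < 1 / M powr (2 - i)"
      using that rq by (auto simp: M_def max_def)
    have "real q powr (1 - i) * real q' \<le> M powr (1 - i) * M"
      using i by (intro mult_mono powr_mono2) (auto simp: M_def)
    also have "\<dots> = M powr (1 - i) * M powr 1"
      using M(1) by simp
    also have "\<dots> = M powr (2 - i)"
      by (simp only: powr_add[symmetric]) simp
    finally have "1 / M powr (2 - i) \<le> 1 / (real q powr (1 - i) * real q')"
      using that M by (intro divide_left_mono) auto
    with M have "r ^ Suc k \<le> 1 / (real q powr (1 - i) * real q')"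
      by simp
    then have "r ^ Suc k / c powr i \<le> 1 / (real q powr (1 - i) * real q') / c powr i"
      by (intro divide_right_mono) auto
    also have "\<dots> = (real q powr i / c powr i) / (real q * real q')"
      using that by (simp add: powr_diff)
    also have "\<dots> \<le> real_of_int D / (real q * real q')"
      using qi by (intro divide_right_mono) auto
    also have "\<dots> \<le> \<bar>real_of_int p / real q - real_of_int p' / real q'\<bar>"
      using that Dq by (intro fraction_gap) auto
    finally show ?thesis .
  qed
  obtain p q n p' q' n' where uv: "u = real_of_int p / real q" "v = real_of_int p' / real q'"
    "q \<ge> 1" "q' \<ge> 1" "partial_product d n dvd int q" "partial_product d n' dvd int q'"
    "real q \<le> c * real_of_int (partial_product d n) powr (1 / i)"
    "real q' \<le> c * real_of_int (partial_product d n') powr (1 / i)"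
    "r ^ Suc k < 1 / real q powr (2 - i)" "r ^ Suc k < 1 / real q' powr (2 - i)"
    using u v unfolding dangerous_def by blast
  show ?thesis
  proof (cases "n \<le> n'")
    case True
    then show ?thesis
      using main[of q q' n n' p p'] uv \<open>u \<noteq> v\<close> by simp
  next
    case False
    then have "r ^ Suc k / c powr i \<le> \<bar>v - u\<bar>"
      using main[of q' q n' n p' p] uv \<open>u \<noteq> v\<close> by simp
    then show ?thesis by simp
  qed
qed

section \<open>Membership in \<open>Bad\<close> and the choice of the constant
  \<open>c\<close>\<close>

lemma power_bracket:
  fixes r y :: real
  assumes r: "0 < r" "r < 1" and y: "0 < y" "y \<le> 1"
  obtains k where "r ^ Suc k < y" "y \<le> r ^ k"
proof -
  obtain n where n: "r ^ n < y"
    using real_arch_pow_inv[OF y(1) r(2)] by blast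
  define m where "m = (LEAST n. r ^ n < y)"
  have m: "r ^ m < y"
    unfolding m_def using n by (rule LeastI)
  then obtain k where k: "m = Suc k"
    using y by (cases m) auto
  have "\<not> r ^ k < y"
    using not_less_Least[of k "\<lambda>n. r ^ n < y"] k by (simp add: m_def)
  with m k that show ?thesis by simp
qed

text \<open>The same \<open>c\<close> witnesses membership. If some \<open>q\<close> violated the
  inequality, then with \<open>p\<close> the integer nearest to q x the fraction p / q would be
  dangerous at some scale \<open>k\<close>, and |x - p/q| \<le> (c/q)^j / q = c^j q^(-1-j) \<le> c^j
  r^k.\<close>

lemma Bad_if_away_from_dangerous:
  assumes ij: "0 < i" "i < 1" "i + j = 1" and d: "\<forall>k\<ge>1. d k \<ge> 2" and c: "c > 0"
    and r: "0 < r" "r < 1"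
    and away: "\<And>k z. z \<in> dangerous d i c r k \<Longrightarrow> \<bar>x - z\<bar> > c powr j * r ^ k"
  shows "x \<in> Bad d i j"
  unfolding Bad_def
proof (intro CollectI exI[of _ c] conjI allI impI c)
  fix q :: nat assume q: "q \<ge> 1"
  show "max (dadic_abs d q powr (1 / i)) (dist_nearest_int (real q * x) powr (1 / j)) > c / real q"
  proof (rule ccontr)
    assume "\<not> ?thesis"
    then have le: "dadic_abs d q powr (1 / i) \<le> c / real q"
      "dist_nearest_int (real q * x) powr (1 / j) \<le> c / real q"
      by auto
    have j: "j > 0" using ij by simp
    obtain n where n: "partial_product d n dvd int q"
      "dadic_abs d q = 1 / real_of_int (partial_product d n)"
      using dadic_abs_attained[OF d q] .
    have "(2::int) ^ n > 0" by simp
    then have D: "partial_product d n > 0"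
      using partial_product_ge_power[OF d, of n] by linarith
    have qD: "real q \<le> c * real_of_int (partial_product d n) powr (1 / i)"
      using le(1) n(2) D q by (simp add: powr_divide field_simps)
    have "1 \<le> real q powr (2 - i)"
      using q ij by (intro ge_one_powr_ge_zero) auto
    then have "0 < 1 / real q powr (2 - i)" "1 / real q powr (2 - i) \<le> 1"
      using q by auto
    then obtain k where k: "r ^ Suc k < 1 / real q powr (2 - i)" "1 / real q powr (2 - i) \<le> r ^ k"
      by (rule power_bracket[OF r])
    define p where "p = round (real q * x)"
    have z: "real_of_int p / real q \<in> dangerous d i c r k"
      using q n(1) qD k unfolding dangerous_def by blast
    have "(dist_nearest_int (real q * x) powr (1 / j)) powr j \<le> (c / real q) powr j"
      using le(2) j by (intro powr_mono2) auto
    then have "\<bar>real q * x - real_of_int p\<bar> \<le> (c / real q) powr j"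
      using j by (simp add: powr_powr dist_nearest_int_def p_def)
    then have "\<bar>x - real_of_int p / real q\<bar> * real q \<le> (c / real q) powr j"
      using q by (simp add: abs_mult_pos[symmetric] field_simps)
    then have "\<bar>x - real_of_int p / real q\<bar> \<le> (c / real q) powr j / real q"
      using q by (simp add: field_simps)
    also have "\<dots> = c powr j * (1 / (real q powr j * real q powr 1))"
      using c q by (simp add: powr_divide)
    also have "\<dots> = c powr j * (1 / real q powr (2 - i))"
    proof -
      have "j + 1 = 2 - i" using ij(3) by simp
      then show ?thesis by (simp only: powr_add[symmetric])
    qed
    also have "\<dots> \<le> c powr j * r ^ k"
      using k by (intro mult_left_mono) auto
    finally show False
      using away[OF z] by simp
  qed
qed

lemma exists_small_powr:
  fixes i j a b :: real
  assumes "0 < i" "0 < j" "0 < a" "0 < b"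
  obtains c where "c > 0" "c powr i < a" "c powr j < b"
proof -
  \<comment> \<open>Halving \<open>a\<close> and \<open>b\<close> makes the resulting inequalities
    strict.\<close>
  define c where "c = min ((a / 2) powr (1 / i)) ((b / 2) powr (1 / j))"
  have c: "c > 0"
    using assms by (simp add: c_def)
  have "c powr i \<le> ((a / 2) powr (1 / i)) powr i"
    using assms c by (intro powr_mono2) (auto simp: c_def)
  then have 1: "c powr i < a"
    using assms by (simp add: powr_powr)
  have "c powr j \<le> ((b / 2) powr (1 / j)) powr j"
    using assms c by (intro powr_mono2) (auto simp: c_def)
  then have 2: "c powr j < b"
    using assms by (simp add: powr_powr)
  show ?thesis
    using that[OF c 1 2] .
qed

lemma pair_winning_Bad:
  assumes ij: "0 < i" "i < 1" "0 < j" "i + j = 1" and d: "\<forall>k\<ge>1. d k \<ge> 2"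
    and adm: "admissible_pair \<alpha> \<beta>"
  shows "pair_winning \<alpha> \<beta> (Bad d i j)"
proof -
  define \<gamma> where "\<gamma> = 1 - 2 * \<alpha> + \<alpha> * \<beta>"
  have \<gamma>: "\<gamma> > 0" and prod: "0 < \<alpha> * \<beta>" "\<alpha> * \<beta> < 1"
    using adm mult_strict_mono[of \<alpha> 1 \<beta> 1] by (auto simp: admissible_pair_def \<gamma>_def)
  obtain s where s: "(\<alpha> * \<beta>) ^ s < \<gamma> / 2"
    using real_arch_pow_inv[OF _ prod(2), of "\<gamma> / 2"] \<gamma> by auto
  \<comment> \<open>The successor ensures that a block has at least one round and that r <
    1.\<close>
  define t where "t = Suc s"
  define r where "r = (\<alpha> * \<beta>) ^ t"
  have "(\<alpha> * \<beta>) ^ t \<le> (\<alpha> * \<beta>) ^ s"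
    unfolding t_def using prod by (intro power_decreasing) auto
  with s have t: "0 < t" "(\<alpha> * \<beta>) ^ t \<le> \<gamma> / 2"
    by (auto simp: t_def)
  have r: "0 < r" "r < 1"
    using prod t(1) by (auto simp: r_def power_less_one_iff)
  show ?thesis
  proof (rule pair_winning_if_separated[OF adm t[unfolded \<gamma>_def]], fold \<gamma>_def r_def)
    fix \<rho> :: real assume \<rho>: "\<rho> > 0"
    \<comment> \<open>The first bound lifts the gap r^(k+1) / c^i above 4 \<rho> r^k; the second
      brings the danger radius c^j r^k below the distance \<gamma>/2 \<rho> r^k that Alice
      secures.\<close>
    obtain c where c: "c > 0" "c powr i < r / (4 * \<rho>)" "c powr j < \<gamma> / 2 * \<rho>"
      using exists_small_powr[OF ij(1,3), of "r / (4 * \<rho>)" "\<gamma> / 2 * \<rho>"] r \<rho> \<gamma> by auto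
    have "u = v" if "u \<in> dangerous d i c r k" "v \<in> dangerous d i c r k"
      "\<bar>u - v\<bar> \<le> 4 * \<rho> * r ^ k" for u v k
    proof (rule ccontr)
      assume "u \<noteq> v"
      then have "r ^ Suc k / c powr i \<le> 4 * \<rho> * r ^ k"
        using dangerous_separated[OF ij(1,2) d c(1) r(1) that(1,2)] that(3) by simp
      then have "r / c powr i * r ^ k \<le> 4 * \<rho> * r ^ k"
        by simp
      then have "r / c powr i \<le> 4 * \<rho>"
        using r by (subst (asm) mult_le_cancel_right) auto
      then show False
        using c \<rho> by (simp add: field_simps)
    qed
    moreover have "x \<in> Bad d i j"
      if away: "\<forall>k. \<forall>z\<in>dangerous d i c r k. \<gamma> / 2 * (\<rho> * r ^ k) \<le> \<bar>x - z\<bar>" for x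
    proof (rule Bad_if_away_from_dangerous[OF ij(1,2,4) d c(1) r])
      fix k z assume "z \<in> dangerous d i c r k"
      then have "\<gamma> / 2 * \<rho> * r ^ k \<le> \<bar>x - z\<bar>"
        using away by (simp add: mult.assoc)
      moreover have "c powr j * r ^ k < \<gamma> / 2 * \<rho> * r ^ k"
        using c r by (intro mult_strict_right_mono) auto
      ultimately show "\<bar>x - z\<bar> > c powr j * r ^ k" by simp
    qed
    ultimately show "\<exists>Z. (\<forall>k. \<forall>u\<in>Z k. \<forall>v\<in>Z k. \<bar>u - v\<bar> \<le> 4 * \<rho> * r ^ k \<longrightarrow> u = v) \<and>
        (\<forall>x. (\<forall>k. \<forall>z\<in>Z k. \<gamma> / 2 * (\<rho> * r ^ k) \<le> \<bar>x - z\<bar>) \<longrightarrow> x \<in> Bad d i j)"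
      by (intro exI[of _ "dangerous d i c r"]) blast
  qed
qed

theorem theorem1p1:
  fixes i j :: real and d :: "nat \<Rightarrow> int"
  assumes "0 < i" and "i < 1" and "0 < j" and "j < 1" and "i + j = 1"
    and "bounded (d ` {1..})"
    and "\<forall>k\<ge>1. d k \<ge> 2"
  shows "(\<forall>\<alpha> \<beta>. admissible_pair \<alpha> \<beta> \<longrightarrow> pair_winning \<alpha> \<beta> (Bad d i j)) \<and> winning (1 / 2) (Bad d i j)"
proof -
  have "pair_winning \<alpha> \<beta> (Bad d i j)" if "admissible_pair \<alpha> \<beta>" for \<alpha> \<beta>
    using pair_winning_Bad[OF assms(1-3,5,7) that] .
  \<comment> \<open>For \<alpha> = 1/2 the quantity 1 - 2 \<alpha> + \<alpha> \<beta> is \<beta>/2,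
    which is positive.\<close>
  moreover have "admissible_pair (1 / 2) \<beta>" if "0 < \<beta>" "\<beta> < 1" for \<beta> :: real
    using that by (simp add: admissible_pair_def)
  ultimately show ?thesis
    unfolding winning_def by blast
qed

end
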